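(* Let $\mathcal{M}=(G,In,Out,Leak)$ be a linear compartmental model with $n$ compartments that has an input and an output in compartment $1$ and no other inputs or outputs. Let $A$ be its compartmental matrix, and write its input-output equation $\det(\partial I-A)\,y_1=\det((\partial I-A)_{11})\,u_1$ as $$y_1^{(n)}+c_{n-1}y_1^{(n-1)}+\dots+c_1y_1'+c_0y_1=u_1^{(n-1)}+d_{n-2}u_1^{(n-2)}+\dots+d_1u_1'+d_0u_1 .$$ Then $$c_i=\sum_{F\in\mathcal{F}_{n-i}(\widetilde G)}\pi_F\quad\text{for } i=0,1,\dots,n-1,\qquad\text{and}\qquad d_i=\sum_{F\in\mathcal{F}_{n-i-1}(\widetilde G_1)}\pi_F\quad\text{for } i=0,1,\dots,n-2 .$$
   Context: A linear compartmental model $\mathcal{M}=(G,In,Out,Leak)$ consists of a finite directed graph $G=(V,E)$ (no self-loops, no repeated edges) with $V=\{1,\dots,n\}$ and subsets $In,Out,Leak\subseteq V$. Each edge $i\to j$ carries a parameter (label) $a_{ji}$ and each leak $i\in Leak$ a parameter $a_{0i}$. The compartmental matrix is the $n\times n$ matrix $A$ with $A_{ij}=a_{ij}$ if $i\ne j$ and $j\to i$ is an edge, $A_{ij}=0$ if $i\ne j$ and $j\to i$ is not an edge, and $A_{ii}=-\sum_{k:\,i\to k\in E}a_{ki}$, with an additional summand $-a_{0i}$ if $i\in Leak$. Here $\partial=d/dt$, and $(\partial I-A)_{11}$ is $\partial I-A$ with row 1 and column 1 removed. Thus $c_i$ is the coefficient of $\lambda^i$ in $\det(\lambda I-A)$ and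 $d_i$ is the coefficient of $\lambda^i$ in $\det((\lambda I-A)_{11})$. The leak-augmented graph $\widetilde G$ is obtained from $G$ by adding a new node $0$ and an edge $j\to 0$ labeled $a_{0j}$ for every $j\in Leak$. The graph $\widetilde G_1$ is obtained from $\widetilde G$ as follows: take the induced (edge-labeled) subgraph on $\{0,2,\dots,n\}$; then, for each edge $j\to 1$ (label $a_{1j}$) of $\widetilde G$: if $j\in Leak$, relabel the edge $j\to 0$ by $a_{0j}+a_{1j}$; if $j\notin Leak$, add an edge $j\to 0$ with label $a_{1j}$. A spanning subgraph of a directed graph is a subgraph with the same vertex set. An incoming forest is a directed graph such that (a) the underlying undirected graph has no cycles (a pair of edges $i\to j$, $j\to i$ counts as a cycle) and (b) each node has at most one outgoing edge. For an incoming forest $F$, $\pi_F$ is the product of the labels of all its edges. $\mathcal{F}_k(H)$ denotes the set of all $k$-edge, spanning, incoming forests of $H$ (i.e. spanning subgraphs of $H$ that are incoming forests with exactly $k$ edges). *)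

theory Defs
  imports
    "Graph_Theory.Digraph_Component"
    "Jordan_Normal_Form.Char_Poly"
begin

record compartmental_model =
  model_graph :: "nat pair_pre_digraph"
  inputs :: "nat set"
  outputs :: "nat set"
  leaks :: "nat set"

text \<open>
  An arc \<open>(i, j)\<close> stands for the edge \<open>i \<rightarrow> j\<close>; the library predicate \<open>pair_digraph\<close> says that the
  digraph is well-formed, finite and free of self-loops (parallel arcs cannot occur).
\<close>

definition linear_compartmental_model :: "nat \<Rightarrow> compartmental_model \<Rightarrow> bool" where
  "linear_compartmental_model n M \<longleftrightarrow>
     pair_digraph (model_graph M) \<and> pverts (model_graph M) = {1..n} \<and>
     inputs M \<subseteq> {1..n} \<and> outputs M \<subseteq> {1..n} \<and> leaks M \<subseteq> {1..n}"

text \<open>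
  Parameters are elements of an arbitrary commutative ring: \<open>a j i\<close> is the label of the edge
  \<open>i \<rightarrow> j\<close>, and \<open>a 0 i\<close> is the label of the leak at \<open>i\<close>. Taking the ring to be a polynomial ring and
  \<open>a\<close> its indeterminates gives the case of formal parameters. Values of \<open>a\<close> at pairs that are
  neither edges nor leaks are never used.

  Matrix indices start from 0, so row \<open>r\<close> belongs to compartment \<open>r + 1\<close>.
\<close>

definition compartmental_matrix ::
  "nat \<Rightarrow> compartmental_model \<Rightarrow> (nat \<Rightarrow> nat \<Rightarrow> 'a::comm_ring_1) \<Rightarrow> 'a mat" where
  "compartmental_matrix n M a = mat n n (\<lambda>(r, s).
     let i = r + 1; j = s + 1; E = parcs (model_graph M) in
     if i \<noteq> j then (if (j, i) \<in> E then a i j else 0)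
     else - (\<Sum>k \<in> {k. (i, k) \<in> E}. a k i) - (if i \<in> leaks M then a 0 i else 0))"

text \<open>
  The two sides of the input-output equation
  \<open>det (\<partial>I - A) y\<^sub>1 = det ((\<partial>I - A)\<^sub>1\<^sub>1) u\<^sub>1\<close> as polynomials in \<open>\<partial>\<close> (the parameters are constant in
  time, so they commute with \<open>\<partial>\<close>). The library's \<open>char_poly_matrix A\<close> is \<open>\<partial>I - A\<close>; deleting row
  and column 0 removes those of compartment 1.
\<close>

definition output_operator ::
  "nat \<Rightarrow> compartmental_model \<Rightarrow> (nat \<Rightarrow> nat \<Rightarrow> 'a::comm_ring_1) \<Rightarrow> 'a poly" where
  "output_operator n M a = det (char_poly_matrix (compartmental_matrix n M a))"

definition input_operator ::
  "nat \<Rightarrow> compartmental_model \<Rightarrow> (nat \<Rightarrow> nat \<Rightarrow> 'a::comm_ring_1) \<Rightarrow> 'a poly" where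
  "input_operator n M a = det (mat_delete (char_poly_matrix (compartmental_matrix n M a)) 0 0)"

definition output_coeff ::
  "nat \<Rightarrow> compartmental_model \<Rightarrow> (nat \<Rightarrow> nat \<Rightarrow> 'a::comm_ring_1) \<Rightarrow> nat \<Rightarrow> 'a" where
  "output_coeff n M a i = coeff (output_operator n M a) i"

definition input_coeff ::
  "nat \<Rightarrow> compartmental_model \<Rightarrow> (nat \<Rightarrow> nat \<Rightarrow> 'a::comm_ring_1) \<Rightarrow> nat \<Rightarrow> 'a" where
  "input_coeff n M a i = coeff (input_operator n M a) i"

record 'a labelled_digraph =
  underlying :: "nat pair_pre_digraph"
  edge_label :: "nat \<times> nat \<Rightarrow> 'a"

definition leak_augmented ::
  "compartmental_model \<Rightarrow> (nat \<Rightarrow> nat \<Rightarrow> 'a) \<Rightarrow> 'a labelled_digraph" where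
  "leak_augmented M a =
     \<lparr> underlying =
         \<lparr> pverts = insert 0 (pverts (model_graph M)),
           parcs = parcs (model_graph M) \<union> {(j, 0) | j. j \<in> leaks M} \<rparr>,
       edge_label = (\<lambda>(i, j). a j i) \<rparr>"

text \<open>
  The graph \<open>\<tilde>G\<^sub>1\<close>: every edge \<open>j \<rightarrow> 1\<close> of the leak-augmented graph is redirected to node 0, where
  its label is added to that of an already existing edge \<open>j \<rightarrow> 0\<close>.
\<close>

definition leak_augmented_1 ::
  "compartmental_model \<Rightarrow> (nat \<Rightarrow> nat \<Rightarrow> 'a::comm_ring_1) \<Rightarrow> 'a labelled_digraph" where
  "leak_augmented_1 M a =
     (let H = underlying (leak_augmented M a); l = edge_label (leak_augmented M a) in
     \<lparr> underlying =
         \<lparr> pverts = pverts H - {1},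
           parcs = {(i, j) \<in> parcs H. i \<noteq> 1 \<and> j \<noteq> 1} \<union> {(j, 0) | j. (j, 1) \<in> parcs H} \<rparr>,
       edge_label = (\<lambda>(i, j).
         if j = 0 \<and> (i, 1) \<in> parcs H
         then (if i \<in> leaks M then l (i, 0) + l (i, 1) else l (i, 1))
         else l (i, j)) \<rparr>)"

text \<open>
  A cycle of the underlying undirected multigraph is either a pair of opposite arcs (or a loop, for
  \<open>i = j\<close>), or a cycle of length at least 3 of the symmetrised digraph. The bound on the length is
  needed because in the symmetrised digraph each single edge yields a cycle of length 2.
\<close>

definition has_undirected_cycle :: "'v pair_pre_digraph \<Rightarrow> bool" where
  "has_undirected_cycle F \<longleftrightarrow>
     (\<exists>i j. (i, j) \<in> parcs F \<and> (j, i) \<in> parcs F) \<or>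
     (\<exists>p. pre_digraph.cycle (with_proj (mk_symmetric (with_proj F))) p \<and> length p \<ge> 3)"

definition incoming_forest :: "'v pair_pre_digraph \<Rightarrow> bool" where
  "incoming_forest F \<longleftrightarrow>
     pair_fin_digraph F \<and> \<not> has_undirected_cycle F \<and>
     (\<forall>v \<in> pverts F. out_degree (with_proj F) v \<le> 1)"

definition spanning_incoming_forests :: "nat \<Rightarrow> 'a labelled_digraph \<Rightarrow> nat pair_pre_digraph set" where
  "spanning_incoming_forests k H =
     {F. spanning (with_proj F) (with_proj (underlying H)) \<and> incoming_forest F \<and>
         card (parcs F) = k}"

definition label_product :: "'a::comm_ring_1 labelled_digraph \<Rightarrow> nat pair_pre_digraph \<Rightarrow> 'a" where
  "label_product H F = (\<Prod>e \<in> parcs F. edge_label H e)"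

end

theory Submission
  imports Defs
begin

text \<open>
  Transposed, both characteristic matrices have in the row of node \<open>i\<close> the vector
  \<open>\<lambda> e\<^sub>i + (\<Sum>k. a\<^sub>k\<^sub>i (e\<^sub>i - e\<^sub>k))\<close>, where \<open>k\<close> ranges over the out-neighbours of \<open>i\<close> and \<open>e\<^sub>0 = 0\<close>;
  for \<open>(\<partial>I - A)\<^sub>1\<^sub>1\<close> the node 1 is merged into the root 0. By multilinearity the determinant is a sum
  over all ways to choose, for every node, either \<open>\<lambda> e\<^sub>i\<close> or one outgoing edge. The remaining matrix of
  vectors \<open>e\<^sub>i\<close> and \<open>e\<^sub>i - e\<^sub>k\<close> has determinant 1 if the chosen edges contain no directed cycle and 0
  otherwise. With at most one outgoing edge per node, having no directed cycle is the same as having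
  no undirected one, so the surviving choices are the spanning incoming forests, and the
  exponent of \<open>\<lambda>\<close> counts the nodes without a chosen edge.
\<close>

section \<open>Forests and directed cycles\<close>

lemma pcas_nth_Suc:
  assumes "pcas u p v" "Suc i < length p"
  shows "snd (p ! i) = fst (p ! Suc i)"
  using assms
proof (induction p arbitrary: u i)
  case (Cons e p)
  then show ?case by (cases i; cases p) auto
qed simp

lemma pcas_last_hd:
  assumes "pcas u p v" "p \<noteq> []"
  shows "snd (last p) = v" "fst (hd p) = u"
  using assms by (induction p arbitrary: u) auto

lemma tl_pawalk_verts: "pcas u p v \<Longrightarrow> tl (pawalk_verts u p) = map snd p"
proof (induction p arbitrary: u)
  case (Cons e p)
  then show ?case by (cases p) auto
qed simp

text \<open>A vertex of the undirected cycle that is minimal for the acyclic arc relation would have to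
  be the tail of both of its cycle arcs.\<close>

lemma no_long_cycle_mk_symmetric:
  assumes fin: "finite (parcs F)" and ac: "acyclic (parcs F)"
    and uniq: "\<And>u v w. (u, v) \<in> parcs F \<Longrightarrow> (u, w) \<in> parcs F \<Longrightarrow> v = w"
    and cyc: "pre_digraph.cycle (with_proj (mk_symmetric (with_proj F))) p"
  shows "length p < 3"
proof (rule ccontr)
  assume "\<not> length p < 3"
  then have len: "length p \<ge> 3" by simp
  obtain u where sub: "set p \<subseteq> parcs (mk_symmetric (with_proj F))"
    and cas: "pcas u p u" and dist: "distinct (tl (pawalk_verts u p))"
    using cyc by (auto simp: pre_digraph.cycle_def pre_digraph.awalk_def
        cas_with_proj_eq awalk_verts_with_proj_eq)
  have dist: "distinct (map snd p)"
    using dist tl_pawalk_verts[OF cas] by simp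
  let ?k = "length p"
  \<comment> \<open>\<open>nx\<close> and \<open>pr\<close> are the cyclic successor and predecessor
    of an index. They differ at every index because the length is at least 3; for length 2 they
    would coincide.\<close>
  define nx where "nx i = (if Suc i = ?k then 0 else Suc i)" for i
  define pr where "pr i = (if i = 0 then ?k - 1 else i - 1)" for i
  have nx_less: "nx i < ?k" and pr_less: "pr i < ?k" and pr_nx: "pr i \<noteq> nx i"
    and nx_pr: "nx (pr i) = i" if "i < ?k" for i
    using that len by (auto simp: nx_def pr_def)
  have ends: "fst (p ! 0) = u" "snd (p ! (?k - 1)) = u"
    using pcas_last_hd[OF cas] len by (cases "p = []"; simp add: hd_conv_nth last_conv_nth)+
  have link: "fst (p ! nx i) = snd (p ! i)" if "i < ?k" for i
  proof (cases "Suc i = ?k")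
    case True
    then have "i = ?k - 1" by simp
    then show ?thesis using True ends by (simp add: nx_def)
  next
    case False
    then show ?thesis using pcas_nth_Suc[OF cas, of i] that by (simp add: nx_def)
  qed
  have sym: "(fst (p ! i), snd (p ! i)) \<in> parcs F \<or> (snd (p ! i), fst (p ! i)) \<in> parcs F"
    if "i < ?k" for i
    using sub nth_mem[OF that] by (auto simp: parcs_mk_symmetric)
  let ?Q = "snd ` set p"
  have "wf (parcs F)" using finite_acyclic_wf[OF fin ac] .
  moreover have "u \<in> ?Q" using ends(2) len nth_mem[of "?k - 1" p] by (force intro: rev_image_eqI)
  ultimately obtain z where z: "z \<in> ?Q" and minz: "\<And>y. (y, z) \<in> parcs F \<Longrightarrow> y \<notin> ?Q"
    by (metis wfE_min)
  obtain i where i: "i < ?k" "z = snd (p ! i)" using z by (auto simp: in_set_conv_nth)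
  have "fst (p ! i) = snd (p ! pr i)" using link[OF pr_less[OF i(1)]] nx_pr[OF i(1)] by simp
  moreover have "snd (p ! pr i) \<in> ?Q" "snd (p ! nx i) \<in> ?Q"
    using nx_less[OF i(1)] pr_less[OF i(1)] by auto
  ultimately have "(z, snd (p ! pr i)) \<in> parcs F" "(z, snd (p ! nx i)) \<in> parcs F"
    using sym[OF i(1)] sym[OF nx_less[OF i(1)]] link[OF i(1)] i(2) minz by auto
  then have "snd (p ! pr i) = snd (p ! nx i)" by (rule uniq)
  then show False
    using dist pr_nx[OF i(1)] nx_less[OF i(1)] pr_less[OF i(1)]
    by (metis distinct_conv_nth length_map nth_map)
qed

text \<open>A closed directed walk contains a directed cycle. From length 3 on it is also a cycle of
  the symmetrised digraph; lengths 1 and 2 are a loop and a pair of opposite arcs, which the first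
  clause of \<open>has_undirected_cycle\<close> catches.\<close>

lemma has_undirected_cycle_if_not_acyclic:
  assumes F: "pair_fin_digraph F" and nac: "\<not> acyclic (parcs F)"
  shows "has_undirected_cycle F"
proof -
  interpret pair_fin_digraph F by (rule F)
  obtain x where "(x, x) \<in> (parcs F)\<^sup>+" using nac by (auto simp: acyclic_def)
  then obtain q where "awalk x q x" "q \<noteq> []" by (auto simp: reachable1_awalk)
  then obtain p where p: "cycle p" using closed_w_imp_cycle by (auto simp: closed_w_def)
  then obtain u where p': "u \<in> pverts F" "set p \<subseteq> parcs F" "pcas u p u"
      "distinct (tl (pawalk_verts u p))" "p \<noteq> []"
    by (auto simp: cycle_def awalk_def)
  show ?thesis
  proof (cases "length p \<ge> 3")
    case True
    have "pre_digraph.cycle (with_proj (mk_symmetric (with_proj F))) p"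
      using p' by (auto simp: pre_digraph.cycle_def pre_digraph.awalk_def
        cas_with_proj_eq awalk_verts_with_proj_eq parcs_mk_symmetric intro!: exI[of _ u])
    then show ?thesis using True by (auto simp: has_undirected_cycle_def)
  next
    case False
    then consider e where "p = [e]" | e e' where "p = [e, e']"
      using p'(5) by (cases p; cases "tl p"; cases "tl (tl p)") auto
    then show ?thesis
    proof cases
      case 1
      then show ?thesis using p' unfolding has_undirected_cycle_def
        by (metis list.set_intros(1) pcas.simps prod.collapse subset_iff)
    next
      case 2
      then have "(fst e, snd e) \<in> parcs F" "(snd e, fst e) \<in> parcs F"
        using p' by (cases e'; auto)+
      then show ?thesis unfolding has_undirected_cycle_def by blast
    qed
  qed
qed

text \<open>Turns the forest condition into one on the arc set alone, so that it can be tested on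
  \<open>choice_arcs\<close>, where uniqueness of the out-neighbour is automatic.\<close>

lemma incoming_forest_iff_acyclic:
  assumes F: "pair_fin_digraph F"
  shows "incoming_forest F \<longleftrightarrow>
    acyclic (parcs F) \<and> (\<forall>u v w. (u, v) \<in> parcs F \<longrightarrow> (u, w) \<in> parcs F \<longrightarrow> v = w)"
proof -
  interpret pair_fin_digraph F by (rule F)
  have deg: "out_degree (with_proj F) u \<le> 1 \<longleftrightarrow>
      (\<forall>v w. (u, v) \<in> parcs F \<longrightarrow> (u, w) \<in> parcs F \<longrightarrow> v = w)" for u
  proof -
    have "finite (out_arcs (with_proj F) u)" by (simp add: out_arcs_def pair_finite_arcs)
    then have "out_degree (with_proj F) u \<le> 1 \<longleftrightarrow>
        (\<forall>e \<in> out_arcs (with_proj F) u. \<forall>e' \<in> out_arcs (with_proj F) u. e = e')"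
      unfolding out_degree_def by (simp add: card_le_Suc0_iff_eq)
    then show ?thesis by (fastforce simp: out_arcs_def)
  qed
  have uniq: "(\<forall>u \<in> pverts F. out_degree (with_proj F) u \<le> 1) \<longleftrightarrow>
      (\<forall>u v w. (u, v) \<in> parcs F \<longrightarrow> (u, w) \<in> parcs F \<longrightarrow> v = w)"
    unfolding deg using in_arcsD1 by blast
  have "has_undirected_cycle F \<longleftrightarrow> \<not> acyclic (parcs F)"
    if u: "\<And>u v w. (u, v) \<in> parcs F \<Longrightarrow> (u, w) \<in> parcs F \<Longrightarrow> v = w"
  proof
    assume cyc: "has_undirected_cycle F"
    show "\<not> acyclic (parcs F)"
    proof
      assume ac: "acyclic (parcs F)"
      have "(j, i) \<notin> parcs F" if "(i, j) \<in> parcs F" for i j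
        using ac that unfolding acyclic_def by (meson r_into_trancl' trancl_into_trancl)
      then show False
        using cyc no_long_cycle_mk_symmetric[OF pair_finite_arcs ac u]
        unfolding has_undirected_cycle_def by fastforce
    qed
  qed (rule has_undirected_cycle_if_not_acyclic[OF F])
  then show ?thesis unfolding incoming_forest_def uniq using F by blast
qed

section \<open>The determinant of a choice of edges\<close>

text \<open>
  Matrix index \<open>r\<close> belongs to node \<open>r + s\<close>, node 0 is the root. The choice \<open>k = r + s\<close>, which is never an
  edge since there are no loops, encodes that node \<open>r + s\<close> has no outgoing edge.
\<close>

definition choice_row :: "nat \<Rightarrow> nat \<Rightarrow> nat \<Rightarrow> nat \<Rightarrow> 'a::comm_ring_1 vec" where
  "choice_row s m r k = vec m (\<lambda>c. of_bool (c = r) - of_bool (k \<noteq> r + s \<and> c + s = k))"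

definition choice_arcs :: "nat \<Rightarrow> nat \<Rightarrow> (nat \<Rightarrow> nat) \<Rightarrow> (nat \<times> nat) set" where
  "choice_arcs s m f = {(r + s, f r) | r. r < m \<and> f r \<noteq> r + s}"

lemma finite_choice_arcs: "finite (choice_arcs s m f)"
proof -
  have "choice_arcs s m f \<subseteq> (\<lambda>r. (r + s, f r)) ` {..<m}" by (auto simp: choice_arcs_def)
  then show ?thesis by (rule finite_subset) simp
qed

text \<open>In the Leibniz formula only the identity survives, and the diagonal entries are 1. An
  off-diagonal entry is nonzero only along a chosen arc, so a nonzero product for another
  permutation would force its moved points to run along a directed cycle.\<close>

lemma det_choice_acyclic:
  assumes ac: "acyclic (choice_arcs s m f)"
  shows "det (mat\<^sub>r m m (\<lambda>r. choice_row s m r (f r))) = (1 :: 'a::comm_ring_1)"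
proof -
  let ?M = "mat\<^sub>r m m (\<lambda>r. choice_row s m r (f r)) :: 'a mat"
  have entry: "?M $$ (r, c) = of_bool (c = r) - of_bool (f r \<noteq> r + s \<and> c + s = f r)"
    if "r < m" "c < m" for r c
    using that by (simp add: choice_row_def)
  have zero: "(\<Prod>i = 0..<m. ?M $$ (i, p i)) = 0" if p: "p permutes {0..<m}" and "p \<noteq> id" for p
  proof -
    obtain r0 where "p r0 \<noteq> r0" using \<open>p \<noteq> id\<close> by fastforce
    have "wf (choice_arcs s m f)" using finite_acyclic_wf[OF finite_choice_arcs ac] .
    then obtain z where z: "p z \<noteq> z"
        and minz: "\<And>y. (y + s, z + s) \<in> choice_arcs s m f \<Longrightarrow> p y = y"
      using wfE_min[of "choice_arcs s m f" "r0 + s" "(\<lambda>r. r + s) ` {r. p r \<noteq> r}"] \<open>p r0 \<noteq> r0\<close>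
      by (smt (verit) imageE imageI mem_Collect_eq)
    have "z < m" using z p by (metis atLeastLessThan_iff permutes_def zero_le)
    \<comment> \<open>The preimage \<open>q\<close> of the minimal moved index \<open>z\<close> is
      moved as well. Minimality excludes an arc from \<open>q + s\<close> to \<open>z + s\<close>,
      so the factor in row \<open>q\<close> vanishes.\<close>
    obtain q where q: "p q = z" using p by (metis permutes_def)
    have "q \<noteq> z" using q z by auto
    have "q < m" using q \<open>z < m\<close> \<open>q \<noteq> z\<close> p by (metis atLeastLessThan_iff permutes_def zero_le)
    have "p q \<noteq> q" using q \<open>q \<noteq> z\<close> by simp
    then have "\<not> (f q \<noteq> q + s \<and> z + s = f q)"
      using minz[of q] \<open>q < m\<close> by (auto simp: choice_arcs_def)
    then have "?M $$ (q, p q) = 0"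
      using entry[OF \<open>q < m\<close> \<open>z < m\<close>] q \<open>q \<noteq> z\<close> by simp
    then show ?thesis using \<open>q < m\<close> by (intro prod_zero) auto
  qed
  have "det ?M = (\<Sum>p \<in> {p. p permutes {0..<m}}. signof p * (\<Prod>i = 0..<m. ?M $$ (i, p i)))"
    by (rule det_def') simp
  also have "\<dots> = (\<Sum>p \<in> {id}. signof p * (\<Prod>i = 0..<m. ?M $$ (i, p i)))"
    using zero by (intro sum.mono_neutral_right)
      (auto simp: permutes_id finite_permutations)
  also have "\<dots> = 1" by (auto simp: choice_row_def intro!: prod.neutral)
  finally show ?thesis .
qed

text \<open>The kernel vector is the indicator of the nodes from which the cycle can be reached.\<close>

lemma det_choice_cyclic:
  assumes nac: "\<not> acyclic (choice_arcs s m f)"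
  shows "det (mat\<^sub>r m m (\<lambda>r. choice_row s m r (f r))) = (0 :: 'a::comm_ring_1)"
proof -
  \<comment> \<open>The kernel criterion for a zero determinant needs an integral domain. The
    entries are integers, so the argument runs over \<open>int\<close> and is carried to the given
    ring by \<open>of_int\<close>.\<close>
  let ?M = "mat\<^sub>r m m (\<lambda>r. choice_row s m r (f r)) :: int mat"
  let ?R = "choice_arcs s m f"
  obtain x where x: "(x, x) \<in> ?R\<^sup>+" using nac by (auto simp: acyclic_def)
  then obtain y where "(x, y) \<in> ?R" by (meson tranclD)
  then obtain rx where rx: "x = rx + s" "rx < m" "f rx \<noteq> rx + s"
    by (auto simp: choice_arcs_def)
  define v :: "int vec" where "v = vec m (\<lambda>r. of_bool ((r + s, x) \<in> ?R\<^sup>*))"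
  \<comment> \<open>A node has at most one chosen arc, so every nonempty walk from it passes through
    its out-neighbour. The walk to \<open>x\<close> may be taken nonempty, even from
    \<open>x\<close> itself, because \<open>x\<close> lies on a cycle.\<close>
  have fwd: "(k, x) \<in> ?R\<^sup>* \<longleftrightarrow> (r + s, x) \<in> ?R\<^sup>*" if "r < m" "f r = k" "k \<noteq> r + s" for r k
  proof
    assume "(k, x) \<in> ?R\<^sup>*"
    moreover have "(r + s, k) \<in> ?R" using that by (auto simp: choice_arcs_def)
    ultimately show "(r + s, x) \<in> ?R\<^sup>*" by (rule converse_rtrancl_into_rtrancl[rotated])
  next
    assume "(r + s, x) \<in> ?R\<^sup>*"
    then have "(r + s, x) \<in> ?R\<^sup>+" using x by (metis rtranclD)
    then obtain y where "(r + s, y) \<in> ?R" "(y, x) \<in> ?R\<^sup>*" by (metis tranclD)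
    then show "(k, x) \<in> ?R\<^sup>*" using that by (auto simp: choice_arcs_def)
  qed
  \<comment> \<open>A node that reaches \<open>x\<close> has an outgoing arc and hence a matrix
    index. A chosen target without a column therefore does not reach \<open>x\<close>, and its
    missing term would be 0 anyway.\<close>
  have out: "\<exists>r < m. k = r + s" if "(k, x) \<in> ?R\<^sup>*" for k
  proof -
    have "(k, x) \<in> ?R\<^sup>+" using x that by (metis rtranclD)
    then obtain y where "(k, y) \<in> ?R" by (metis tranclD)
    then show ?thesis by (auto simp: choice_arcs_def)
  qed
  have "row ?M r \<bullet> v = 0" if r: "r < m" for r
  proof -
    have "row ?M r \<bullet> v = (\<Sum>c = 0..<m. (of_bool (c = r) - of_bool (f r \<noteq> r + s \<and> c + s = f r))
        * of_bool ((c + s, x) \<in> ?R\<^sup>*))"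
      using r by (simp add: scalar_prod_def v_def choice_row_def)
    also have "\<dots> = (\<Sum>c = 0..<m. if c = r then of_bool ((r + s, x) \<in> ?R\<^sup>*) else 0)
        - (\<Sum>c = 0..<m. if c + s = f r then of_bool (f r \<noteq> r + s \<and> (f r, x) \<in> ?R\<^sup>*) else 0)"
      unfolding sum_subtractf[symmetric] by (intro sum.cong) auto
    also have "(\<Sum>c = 0..<m. if c + s = f r then of_bool (f r \<noteq> r + s \<and> (f r, x) \<in> ?R\<^sup>*) else 0)
        = (of_bool (f r \<noteq> r + s \<and> (f r, x) \<in> ?R\<^sup>*) :: int)"
    proof (cases "\<exists>c < m. f r = c + s")
      case True
      then obtain c0 where "c0 < m" "f r = c0 + s" by blast
      then show ?thesis by simp
    next
      case False
      then have "(f r, x) \<notin> ?R\<^sup>*" using out by blast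
      then show ?thesis by simp
    qed
    also have "of_bool (f r \<noteq> r + s \<and> (f r, x) \<in> ?R\<^sup>*) = (of_bool ((r + s, x) \<in> ?R\<^sup>*) :: int)"
    proof (cases "f r = r + s")
      case True
      have "(r + s, x) \<notin> ?R\<^sup>*"
      proof
        assume "(r + s, x) \<in> ?R\<^sup>*"
        then have "(r + s, x) \<in> ?R\<^sup>+" using x by (metis rtranclD)
        then obtain y where "(r + s, y) \<in> ?R" by (meson tranclD)
        then show False using True by (auto simp: choice_arcs_def)
      qed
      then show ?thesis by (simp add: True)
    next
      case False
      then show ?thesis using fwd[OF r refl False] by simp
    qed
    finally show ?thesis using r by simp
  qed
  then have "?M *\<^sub>v v = 0\<^sub>v m" by (intro eq_vecI) auto
  moreover have "v \<noteq> 0\<^sub>v m" using rx by (auto simp: v_def vec_eq_iff intro!: exI[of _ rx])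
  moreover have "v \<in> carrier_vec m" by (simp add: v_def)
  ultimately have "det ?M = 0" using det_0_iff_vec_prod_zero[of ?M m] by auto
  moreover have "mat\<^sub>r m m (\<lambda>r. choice_row s m r (f r)) = (map_mat of_int ?M :: 'a mat)"
    by (intro eq_matI) (auto simp: choice_row_def)
  ultimately show ?thesis by (simp add: of_int_hom.hom_det)
qed

section \<open>The forest expansion\<close>

definition node_choices :: "nat \<Rightarrow> nat \<Rightarrow> (nat \<Rightarrow> nat) set" where
  "node_choices s m =
    {f. (\<forall>r \<in> {0..<m}. f r \<in> insert 0 {s..<s + m}) \<and> (\<forall>r. r \<notin> {0..<m} \<longrightarrow> f r = r)}"

lemma finite_node_choices: "finite (node_choices s m)"
  unfolding node_choices_def by (rule finite_bounded_functions) auto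

lemma prod_monom_0: "(\<Prod>x \<in> A. monom (h x) 0) = monom (\<Prod>x \<in> A. h x) 0"
  by (induction A rule: infinite_finite_induct) (simp_all add: mult_monom)

lemma sum_const_poly: "(\<Sum>x \<in> A. [:h x:]) = [:\<Sum>x \<in> A. h x:]"
  by (induction A rule: infinite_finite_induct) simp_all

text \<open>Covers both graphs of the theorem: \<open>s = 1\<close>, \<open>m = n\<close> for the
  leak-augmented graph, and \<open>s = 2\<close>, \<open>m = n - 1\<close> after node 1 is merged
  into the root. Since \<open>s\<close> is positive, the root 0 has no row or column.\<close>

locale rooted_labelled_digraph =
  fixes H :: "'a::comm_ring_1 labelled_digraph" and s m :: nat
  assumes s_pos: "s > 0"
    and verts_H: "pverts (underlying H) = insert 0 {s..<s + m}"
    and arcs_H: "parcs (underlying H) \<subseteq> {s..<s + m} \<times> insert 0 {s..<s + m}"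
    and loopfree_H: "\<And>v. (v, v) \<notin> parcs (underlying H)"
begin

abbreviation "E \<equiv> parcs (underlying H)"
abbreviation "S \<equiv> insert 0 {s..<s + m}"

text \<open>The scalar in front of \<open>choice_row s m r k\<close>, with \<open>monom 1 1\<close>
  as the indeterminate. Weight 0 for non-edges lets all rows be summed over the same set
  \<open>S\<close>, as the multilinear expansion requires.\<close>

definition weight :: "nat \<Rightarrow> nat \<Rightarrow> 'a poly" where
  "weight r k = (if k = r + s then monom 1 1
    else if (r + s, k) \<in> E then monom (edge_label H (r + s, k)) 0 else 0)"

definition forest_choices :: "(nat \<Rightarrow> nat) set" where
  "forest_choices =
    {f \<in> node_choices s m. acyclic (choice_arcs s m f) \<and> choice_arcs s m f \<subseteq> E}"

definition graph_of :: "(nat \<Rightarrow> nat) \<Rightarrow> nat pair_pre_digraph" where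
  "graph_of f = \<lparr> pverts = insert 0 {s..<s + m}, parcs = choice_arcs s m f \<rparr>"

definition forests :: "nat pair_pre_digraph set" where
  "forests = {F. spanning (with_proj F) (with_proj (underlying H)) \<and> incoming_forest F}"

text \<open>This is \<lambda>I + L, where L is the weighted out-degree Laplacian of \<open>H\<close>
  with the row and column of the root deleted.\<close>

definition kirchhoff_matrix :: "'a poly mat" where
  "kirchhoff_matrix = mat m m (\<lambda>(r, c).
    if r = c then monom 1 1 + (\<Sum>k | (r + s, k) \<in> E. monom (edge_label H (r + s, k)) 0)
    else if (r + s, c + s) \<in> E then - monom (edge_label H (r + s, c + s)) 0 else 0)"

text \<open>The choice \<open>k = r + s\<close> supplies the indeterminate on the diagonal; an edge
  to \<open>k\<close> adds its label on the diagonal and subtracts it in the column of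
  \<open>k\<close>, if there is one. In this form multilinearity in the rows applies.\<close>

lemma kirchhoff_matrix_rows:
  "kirchhoff_matrix = mat\<^sub>r m m (\<lambda>r. finsum_vec TYPE('a poly) m
     (\<lambda>k. weight r k \<cdot>\<^sub>v choice_row s m r k) S)"
proof (rule eq_matI, goal_cases)
  case (1 r c)
  then have rc: "r < m" "c < m" by simp_all
  have "finsum_vec TYPE('a poly) m (\<lambda>k. weight r k \<cdot>\<^sub>v choice_row s m r k) S $ c
      = (\<Sum>k\<in>S. weight r k * (of_bool (c = r) - of_bool (k \<noteq> r + s \<and> c + s = k)))"
    using rc by (subst index_finsum_vec) (auto simp: choice_row_def)
  \<comment> \<open>In column \<open>c\<close> the subtracted part is nonzero only for
    \<open>k = c + s\<close>, where the condition \<open>k \<noteq> r + s\<close> becomes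
    \<open>c \<noteq> r\<close>.\<close>
  also have "\<dots> = (\<Sum>k\<in>S. of_bool (c = r) * weight r k)
      - (\<Sum>k\<in>S. if k = c + s then of_bool (c \<noteq> r) * weight r (c + s) else 0)"
    unfolding sum_subtractf[symmetric] by (intro sum.cong refl) (auto simp: algebra_simps)
  also have "\<dots> = of_bool (c = r) * (\<Sum>k\<in>S. weight r k) - of_bool (c \<noteq> r) * weight r (c + s)"
    using rc by (simp add: sum_distrib_left sum.delta)
  also have "(\<Sum>k\<in>S. weight r k) = weight r (r + s) + (\<Sum>k\<in>S - {r + s}. weight r k)"
    using rc by (intro sum.remove) auto
  also have "(\<Sum>k\<in>S - {r + s}. weight r k)
      = (\<Sum>k | (r + s, k) \<in> E. monom (edge_label H (r + s, k)) 0)"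
    using arcs_H loopfree_H by (intro sum.mono_neutral_cong_right) (auto simp: weight_def)
  finally show ?case
    using rc by (auto simp: kirchhoff_matrix_def weight_def)
qed (auto simp: kirchhoff_matrix_def)

lemma card_choice_arcs: "card (choice_arcs s m f) = card {r. r < m \<and> f r \<noteq> r + s}"
proof -
  have "choice_arcs s m f = (\<lambda>r. (r + s, f r)) ` {r. r < m \<and> f r \<noteq> r + s}"
    by (auto simp: choice_arcs_def)
  then show ?thesis by (simp add: card_image inj_on_def)
qed

lemma prod_weight:
  assumes "choice_arcs s m f \<subseteq> E"
  shows "(\<Prod>r = 0..<m. weight r (f r)) =
    monom (\<Prod>e \<in> choice_arcs s m f. edge_label H e) (m - card (choice_arcs s m f))"
proof -
  let ?A = "{r. r < m \<and> f r \<noteq> r + s}"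
  have arcs: "choice_arcs s m f = (\<lambda>r. (r + s, f r)) ` ?A"
    by (auto simp: choice_arcs_def)
  have "(\<Prod>r = 0..<m. weight r (f r))
      = (\<Prod>r \<in> {0..<m} - ?A. weight r (f r)) * (\<Prod>r \<in> ?A. weight r (f r))"
    by (intro prod.subset_diff) auto
  also have "(\<Prod>r \<in> {0..<m} - ?A. weight r (f r)) = (\<Prod>r \<in> {0..<m} - ?A. monom 1 1)"
    by (intro prod.cong) (auto simp: weight_def)
  also have "\<dots> = monom 1 (m - card ?A)"
    by (subst prod_constant, subst card_Diff_subset) (auto simp: monom_power)
  also have "(\<Prod>r \<in> ?A. weight r (f r)) = (\<Prod>r \<in> ?A. monom (edge_label H (r + s, f r)) 0)"
    using assms by (intro prod.cong) (auto simp: weight_def choice_arcs_def)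
  also have "\<dots> = monom (\<Prod>r \<in> ?A. edge_label H (r + s, f r)) 0"
    by (rule prod_monom_0)
  also have "(\<Prod>r \<in> ?A. edge_label H (r + s, f r)) = (\<Prod>e \<in> choice_arcs s m f. edge_label H e)"
    unfolding arcs by (subst prod.reindex) (auto simp: inj_on_def)
  finally show ?thesis
    by (simp add: card_choice_arcs mult_monom)
qed

lemma det_kirchhoff_choices:
  "det kirchhoff_matrix = (\<Sum>f \<in> forest_choices. \<Prod>r = 0..<m. weight r (f r))"
proof -
  have "det kirchhoff_matrix = (\<Sum>f \<in> node_choices s m.
      det (mat\<^sub>r m m (\<lambda>r. weight r (f r) \<cdot>\<^sub>v choice_row s m r (f r))))"
    unfolding kirchhoff_matrix_rows node_choices_def
    by (rule det_linear_rows_sum) (auto simp: choice_row_def)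
  also have "\<dots> = (\<Sum>f \<in> node_choices s m. (\<Prod>r = 0..<m. weight r (f r)) *
      det (mat\<^sub>r m m (\<lambda>r. choice_row s m r (f r))))"
    by (intro sum.cong refl det_rows_mul) (auto simp: choice_row_def)
  also have "\<dots> = (\<Sum>f \<in> forest_choices. \<Prod>r = 0..<m. weight r (f r))"
  \<comment> \<open>A discarded choice vanishes for one of two reasons: if it is cyclic, its
    determinant is 0; if it is acyclic, it uses a non-edge and some weight is 0.\<close>
  proof (intro sum.mono_neutral_cong_right ballI)
    fix f assume f: "f \<in> node_choices s m - forest_choices"
    show "(\<Prod>r = 0..<m. weight r (f r)) * det (mat\<^sub>r m m (\<lambda>r. choice_row s m r (f r))) = 0"
    proof (cases "acyclic (choice_arcs s m f)")
      case True
      then obtain r where "r < m" "f r \<noteq> r + s" "(r + s, f r) \<notin> E"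
        using f by (auto simp: forest_choices_def choice_arcs_def)
      then have "(\<Prod>r = 0..<m. weight r (f r)) = 0"
        by (intro prod_zero) (auto simp: weight_def)
      then show ?thesis by simp
    qed (simp add: det_choice_cyclic)
  qed (auto simp: forest_choices_def finite_node_choices det_choice_acyclic)
  finally show ?thesis .
qed

section \<open>Acyclic choices correspond to spanning incoming forests\<close>

lemma wf_underlying: "wf_digraph (with_proj (underlying H))"
  using arcs_H verts_H by unfold_locales auto

lemma fin_graph_of:
  assumes "f \<in> node_choices s m"
  shows "pair_fin_digraph (graph_of f)"
proof -
  have "choice_arcs s m f \<subseteq> S \<times> S"
  proof
    fix e assume "e \<in> choice_arcs s m f"
    then obtain r where "r < m" "e = (r + s, f r)" by (auto simp: choice_arcs_def)
    moreover from this have "f r \<in> S" using assms by (simp add: node_choices_def)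
    ultimately show "e \<in> S \<times> S" by simp
  qed
  then show ?thesis
    by unfold_locales (auto simp: graph_of_def finite_choice_arcs)
qed

lemma graph_of_forest:
  assumes "f \<in> forest_choices"
  shows "graph_of f \<in> forests"
proof -
  have f: "f \<in> node_choices s m" using assms by (simp add: forest_choices_def)
  interpret G: pair_fin_digraph "graph_of f" using fin_graph_of[OF f] .
  have "incoming_forest (graph_of f)"
    using assms unfolding incoming_forest_iff_acyclic[OF fin_graph_of[OF f]]
    by (auto simp: graph_of_def forest_choices_def choice_arcs_def)
  moreover have "spanning (with_proj (graph_of f)) (with_proj (underlying H))"
    using assms G.wf_digraph_axioms wf_underlying verts_H
    by (auto simp: spanning_def subgraph_def compatible_def graph_of_def forest_choices_def)
  ultimately show ?thesis by (simp add: forests_def)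
qed

lemma inj_graph_of: "inj_on graph_of forest_choices"
proof (rule inj_onI, rule ext)
  fix f g r assume f: "f \<in> forest_choices" and g: "g \<in> forest_choices" and "graph_of f = graph_of g"
  then have eq: "choice_arcs s m f = choice_arcs s m g" by (simp add: graph_of_def)
  have arc_iff: "(r + s, k) \<in> choice_arcs s m h \<longleftrightarrow> r < m \<and> h r = k \<and> k \<noteq> r + s" for h k
    by (auto simp: choice_arcs_def)
  show "f r = g r"
  proof (cases "r < m")
    case True
    then show ?thesis using arc_iff[of _ f] arc_iff[of _ g] eq by metis
  next
    case False
    then show ?thesis using f g by (auto simp: forest_choices_def node_choices_def)
  qed
qed

lemma graph_of_surj:
  assumes "F \<in> forests"
  shows "\<exists>f \<in> forest_choices. F = graph_of f"
proof -
  have span: "spanning (with_proj F) (with_proj (underlying H))" and inc: "incoming_forest F"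
    using assms by (auto simp: forests_def)
  have fin: "pair_fin_digraph F" using inc by (simp add: incoming_forest_def)
  have ac: "acyclic (parcs F)"
    and uniq: "\<And>u v w. (u, v) \<in> parcs F \<Longrightarrow> (u, w) \<in> parcs F \<Longrightarrow> v = w"
    using inc unfolding incoming_forest_iff_acyclic[OF fin] by blast+
  have verts: "pverts F = S" and sub: "parcs F \<subseteq> E"
    using span verts_H by (auto simp: spanning_def subgraph_def)
  \<comment> \<open>Reads the choice off the forest: the head of the outgoing arc, which is unique,
    or the node itself if there is none.\<close>
  define f where "f r = (if r < m then if \<exists>k. (r + s, k) \<in> parcs F
    then THE k. (r + s, k) \<in> parcs F else r + s else r)" for r
  have f_arc: "f r = k" if "r < m" "(r + s, k) \<in> parcs F" for r k
    using that uniq by (auto simp: f_def intro!: the_equality)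
  have arcs: "choice_arcs s m f = parcs F"
  proof (intro subset_antisym subsetI)
    fix e assume "e \<in> choice_arcs s m f"
    then obtain r where r: "e = (r + s, f r)" "r < m" "f r \<noteq> r + s"
      by (auto simp: choice_arcs_def)
    then obtain k where "(r + s, k) \<in> parcs F" by (auto simp: f_def split: if_splits)
    then show "e \<in> parcs F" using r f_arc by auto
  next
    fix e assume e: "e \<in> parcs F"
    then obtain u k where uk: "e = (u, k)" "u \<in> {s..<s + m}" using sub arcs_H by (cases e) auto
    then have "u = (u - s) + s" "u - s < m" by auto
    \<comment> \<open>Without loops, no arc of the forest is mistaken for the code of a missing
      arc.\<close>
    moreover have "k \<noteq> u" using e uk sub loopfree_H by auto
    ultimately show "e \<in> choice_arcs s m f"
      using e uk f_arc[of "u - s" k] by (auto simp: choice_arcs_def intro!: exI[of _ "u - s"])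
  qed
  have "f \<in> node_choices s m"
    unfolding node_choices_def
  proof (intro CollectI conjI ballI allI impI)
    fix r assume r: "r \<in> {0..<m}"
    show "f r \<in> S"
    proof (cases "f r = r + s")
      case False
      then have "(r + s, f r) \<in> parcs F" using r arcs by (auto simp: choice_arcs_def)
      then show ?thesis using sub arcs_H by auto
    qed (use r in auto)
  qed (simp add: f_def)
  then have "f \<in> forest_choices" using ac sub arcs by (simp add: forest_choices_def)
  moreover have "F = graph_of f" using verts arcs by (simp add: graph_of_def)
  ultimately show ?thesis by blast
qed

lemma bij_graph_of: "bij_betw graph_of forest_choices forests"
  unfolding bij_betw_def using inj_graph_of graph_of_forest graph_of_surj by blast

section \<open>The weighted matrix-forest theorem and its coefficients\<close>

theorem det_kirchhoff_matrix:
  "det kirchhoff_matrix = (\<Sum>F \<in> forests. monom (label_product H F) (m - card (parcs F)))"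
proof -
  have "det kirchhoff_matrix = (\<Sum>f \<in> forest_choices.
      monom (label_product H (graph_of f)) (m - card (parcs (graph_of f))))"
    unfolding det_kirchhoff_choices
    by (intro sum.cong refl)
      (simp add: prod_weight forest_choices_def label_product_def graph_of_def)
  also have "\<dots> = (\<Sum>F \<in> forests. monom (label_product H F) (m - card (parcs F)))"
    by (rule sum.reindex_bij_betw[OF bij_graph_of])
  finally show ?thesis .
qed

text \<open>Allows the truncated subtraction to be inverted: for \<open>i \<le> m\<close>, the
  exponent \<open>m - card (parcs F)\<close> is \<open>i\<close> exactly if \<open>F\<close> has
  \<open>m - i\<close> arcs.\<close>

lemma card_forest_le: "F \<in> forests \<Longrightarrow> card (parcs F) \<le> m"
proof -
  assume "F \<in> forests"
  then obtain f where "F = graph_of f" using graph_of_surj by blast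
  moreover have "card {r. r < m \<and> f r \<noteq> r + s} \<le> card {..<m}"
    by (intro card_mono) auto
  ultimately show ?thesis by (simp add: graph_of_def card_choice_arcs)
qed

lemma finite_forests: "finite forests"
  using bij_betw_finite[OF bij_graph_of] finite_node_choices
  by (simp add: forest_choices_def)

lemma coeff_det_kirchhoff_matrix:
  assumes "i \<le> m"
  shows "coeff (det kirchhoff_matrix) i =
    (\<Sum>F \<in> spanning_incoming_forests (m - i) H. label_product H F)"
proof -
  have "coeff (det kirchhoff_matrix) i =
      (\<Sum>F \<in> forests. if m - card (parcs F) = i then label_product H F else 0)"
    unfolding det_kirchhoff_matrix coeff_sum by simp
  also have "\<dots> = (\<Sum>F \<in> {F \<in> forests. card (parcs F) = m - i}. label_product H F)"
  proof (intro sum.mono_neutral_cong_right ballI)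
    fix F assume "F \<in> forests - {F \<in> forests. card (parcs F) = m - i}"
    then show "(if m - card (parcs F) = i then label_product H F else 0) = 0"
      using card_forest_le[of F] by auto
  qed (use assms finite_forests in auto)
  also have "{F \<in> forests. card (parcs F) = m - i} = spanning_incoming_forests (m - i) H"
    by (auto simp: forests_def spanning_incoming_forests_def)
  finally show ?thesis .
qed

lemma degree_det_kirchhoff_matrix_le: "degree (det kirchhoff_matrix) \<le> m"
  unfolding det_kirchhoff_matrix
  by (intro degree_sum_le finite_forests order.trans[OF degree_monom_le]) simp

text \<open>The top coefficient collects the forests without arcs. There is exactly one, given by
  the choice of no outgoing edge at any node, and its label product is empty.\<close>

lemma lead_coeff_det_kirchhoff_matrix: "coeff (det kirchhoff_matrix) m = 1"
proof -
  define f where "f r = (if r < m then r + s else r)" for r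
  have arcs: "choice_arcs s m f = {}" by (auto simp: choice_arcs_def f_def)
  then have "f \<in> forest_choices"
    by (auto simp: forest_choices_def node_choices_def f_def acyclic_def)
  from graph_of_forest[OF this] have "\<lparr> pverts = S, parcs = {} \<rparr> \<in> forests"
    by (simp add: graph_of_def arcs)
  moreover have "F = \<lparr> pverts = S, parcs = {} \<rparr>" if F: "F \<in> forests" "card (parcs F) = 0" for F
  proof -
    obtain f where f: "F = graph_of f" using graph_of_surj[OF F(1)] by blast
    then have "choice_arcs s m f = {}"
      using F(2) finite_choice_arcs[of s m f] by (simp add: graph_of_def)
    then show ?thesis by (simp add: f graph_of_def)
  qed
  moreover have "spanning_incoming_forests 0 H = {F \<in> forests. card (parcs F) = 0}"
    by (simp add: spanning_incoming_forests_def forests_def conj_assoc)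
  moreover have "card (parcs \<lparr> pverts = S, parcs = {} \<rparr>) = 0" by simp
  ultimately have "spanning_incoming_forests 0 H = {\<lparr> pverts = S, parcs = {} \<rparr>}"
    by blast
  then show ?thesis
    using coeff_det_kirchhoff_matrix[of m] by (simp add: label_product_def)
qed

lemma det_kirchhoff_matrix_expand:
  "det kirchhoff_matrix = monom 1 m + (\<Sum>i<m. monom (coeff (det kirchhoff_matrix) i) i)"
proof -
  have "det kirchhoff_matrix = (\<Sum>i\<le>m. monom (coeff (det kirchhoff_matrix) i) i)"
    using poly_as_sum_of_monoms'[OF degree_det_kirchhoff_matrix_le] by simp
  then show ?thesis
    by (simp add: lead_coeff_det_kirchhoff_matrix add.commute flip: lessThan_Suc_atMost)
qed

end

section \<open>Compartmental models\<close>

lemma char_poly_matrix_entry: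
  assumes "r < n" "c < n"
  shows "char_poly_matrix (compartmental_matrix n M a) $$ (r, c) =
    (if r = c then monom 1 1 + (\<Sum>k | (r + 1, k) \<in> parcs (model_graph M). monom (a k (r + 1)) 0)
       + (if r + 1 \<in> leaks M then monom (a 0 (r + 1)) 0 else 0)
     else if (c + 1, r + 1) \<in> parcs (model_graph M) then - monom (a (r + 1) (c + 1)) 0 else 0)"
  using assms
  by (simp add: char_poly_matrix_def compartmental_matrix_def Let_def monom_0 monom_Suc
      sum_const_poly one_pCons)

lemma rooted_leak_augmented:
  assumes "linear_compartmental_model n M"
  shows "rooted_labelled_digraph (leak_augmented M a) 1 n"
proof -
  interpret pair_digraph "model_graph M"
    using assms by (simp add: linear_compartmental_model_def)
  show ?thesis
    using assms in_arcsD1 in_arcsD2 pair_no_loops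
    by unfold_locales (fastforce simp: leak_augmented_def linear_compartmental_model_def)+
qed

text \<open>Since the model graph has no loops, a redirected arc into node 1 has its tail among the
  nodes from 2 to \<open>n\<close>, so redirecting creates neither a loop nor an arc leaving the
  root.\<close>

lemma rooted_leak_augmented_1:
  assumes "linear_compartmental_model n M" "n > 0"
  shows "rooted_labelled_digraph (leak_augmented_1 M a) 2 (n - 1)"
proof -
  interpret pair_digraph "model_graph M"
    using assms by (simp add: linear_compartmental_model_def)
  have V: "pverts (model_graph M) = {1..n}" and L: "leaks M \<subseteq> {1..n}"
    using assms by (simp_all add: linear_compartmental_model_def)
  have E: "1 \<le> i \<and> i \<le> n \<and> 1 \<le> j \<and> j \<le> n \<and> i \<noteq> j" if "(i, j) \<in> parcs (model_graph M)" for i j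
    using in_arcsD1[OF that] in_arcsD2[OF that] pair_no_loops[OF that] V by simp
  show ?thesis
  proof
    show "pverts (underlying (leak_augmented_1 M a)) = insert 0 {2..<2 + (n - 1)}"
      using assms(2) V by (auto simp: leak_augmented_1_def leak_augmented_def Let_def)
    show "parcs (underlying (leak_augmented_1 M a)) \<subseteq> {2..<2 + (n - 1)} \<times> insert 0 {2..<2 + (n - 1)}"
      using assms(2) L by (force simp: leak_augmented_1_def leak_augmented_def Let_def dest: E)
    show "(v, v) \<notin> parcs (underlying (leak_augmented_1 M a))" for v
      using L by (auto simp: leak_augmented_1_def leak_augmented_def Let_def dest: E)
  qed simp
qed

section \<open>Identifying the characteristic matrices with Kirchhoff matrices\<close>

lemma out_sum_leak_augmented:
  fixes a :: "nat \<Rightarrow> nat \<Rightarrow> 'a::comm_ring_1"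
  assumes "linear_compartmental_model n M"
  shows "(\<Sum>k | (i, k) \<in> parcs (underlying (leak_augmented M a)).
      monom (edge_label (leak_augmented M a) (i, k)) 0) =
    (\<Sum>k | (i, k) \<in> parcs (model_graph M). monom (a k i) 0)
       + (if i \<in> leaks M then monom (a 0 i) 0 else 0)"
proof -
  interpret pair_digraph "model_graph M"
    using assms by (simp add: linear_compartmental_model_def)
  let ?N = "{k. (i, k) \<in> parcs (model_graph M)}"
  have N: "?N \<subseteq> {1..n}"
    using in_arcsD2 assms by (auto simp: linear_compartmental_model_def)
  then have fin: "finite ?N" and zero: "0 \<notin> ?N" by (auto intro: finite_subset)
  have "{k. (i, k) \<in> parcs (underlying (leak_augmented M a))} =
      (if i \<in> leaks M then insert 0 ?N else ?N)"
    by (auto simp: leak_augmented_def)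
  then show ?thesis
    using fin zero by (simp add: leak_augmented_def)
qed

text \<open>Merging node 1 into the root preserves the total label leaving every other node. This
  matches the minor, whose diagonal entries still contain the labels of the edges into compartment
  1.\<close>

lemma out_sum_leak_augmented_1:
  fixes a :: "nat \<Rightarrow> nat \<Rightarrow> 'a::comm_ring_1"
  assumes "linear_compartmental_model n M" and i: "i \<noteq> 1"
  shows "(\<Sum>k | (i, k) \<in> parcs (underlying (leak_augmented_1 M a)).
      monom (edge_label (leak_augmented_1 M a) (i, k)) 0) =
    (\<Sum>k | (i, k) \<in> parcs (model_graph M). monom (a k i) 0)
       + (if i \<in> leaks M then monom (a 0 i) 0 else 0)"
proof -
  interpret pair_digraph "model_graph M"
    using assms by (simp add: linear_compartmental_model_def)
  let ?N = "{k. (i, k) \<in> parcs (model_graph M)}" and ?l = "edge_label (leak_augmented_1 M a)"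
  have N: "?N \<subseteq> {1..n}"
    using in_arcsD2 assms by (auto simp: linear_compartmental_model_def)
  then have fin: "finite ?N" and zero: "0 \<notin> ?N" by (auto intro: finite_subset)
  have out: "{k. (i, k) \<in> parcs (underlying (leak_augmented_1 M a))} =
      (if i \<in> leaks M \<or> 1 \<in> ?N then insert 0 (?N - {1}) else ?N - {1})"
    using i by (auto simp: leak_augmented_1_def leak_augmented_def Let_def)
  have l0: "?l (i, 0) = (if 1 \<in> ?N then if i \<in> leaks M then a 0 i + a 1 i else a 1 i else a 0 i)"
    by (simp add: leak_augmented_1_def leak_augmented_def Let_def)
  have "?l (i, k) = a k i" if "k \<in> ?N" for k
    using that zero by (auto simp: leak_augmented_1_def leak_augmented_def Let_def)
  then have rest: "(\<Sum>k \<in> ?N - {1}. monom (?l (i, k)) 0) = (\<Sum>k \<in> ?N - {1}. monom (a k i) 0)"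
    by (intro sum.cong) auto
  show ?thesis
  proof (cases "1 \<in> ?N")
    case True
    \<comment> \<open>The summand split off here reappears in the label of the edge from
      \<open>i\<close> to 0, either alone or added to the leak.\<close>
    then have "(\<Sum>k \<in> ?N. monom (a k i) 0) = monom (a 1 i) 0 + (\<Sum>k \<in> ?N - {1}. monom (a k i) 0)"
      using fin by (intro sum.remove)
    then show ?thesis
      unfolding out using True fin zero rest l0 by (simp add: add_monom[symmetric] algebra_simps)
  next
    case False
    then have "?N - {1} = ?N" by blast
    then show ?thesis
      unfolding out using False fin zero rest l0 by simp
  qed
qed

text \<open>The labels of the edges leaving a node stand in its column of the compartmental matrix
  but in its row of \<open>kirchhoff_matrix\<close>; hence the transpose, which leaves the
  determinant unchanged.\<close>

lemma transpose_output_matrix: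
  fixes a :: "nat \<Rightarrow> nat \<Rightarrow> 'a::comm_ring_1"
  assumes "linear_compartmental_model n M"
  shows "transpose_mat (char_poly_matrix (compartmental_matrix n M a)) =
    rooted_labelled_digraph.kirchhoff_matrix (leak_augmented M a) 1 n" (is "?A = ?B")
proof -
  interpret rooted_labelled_digraph "leak_augmented M a" 1 n
    using rooted_leak_augmented[OF assms] .
  have dim: "compartmental_matrix n M a \<in> carrier_mat n n"
    by (simp add: compartmental_matrix_def)
  show ?thesis
  proof (rule eq_matI)
    fix r c assume "r < dim_row ?B" "c < dim_col ?B"
    then have rc: "r < n" "c < n" unfolding kirchhoff_matrix_def by simp_all
    have "(r + 1, c + 1) \<in> E \<longleftrightarrow> (r + 1, c + 1) \<in> parcs (model_graph M)"
      by (auto simp: leak_augmented_def)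
    moreover have "edge_label (leak_augmented M a) (r + 1, c + 1) = a (c + 1) (r + 1)"
      by (simp add: leak_augmented_def)
    moreover have "?A $$ (r, c) = char_poly_matrix (compartmental_matrix n M a) $$ (c, r)"
      using rc char_poly_matrix_closed[OF dim] by simp
    ultimately show "?A $$ (r, c) = ?B $$ (r, c)"
      unfolding kirchhoff_matrix_def using rc
      by (simp add: char_poly_matrix_entry out_sum_leak_augmented[OF assms] del: One_nat_def)
  qed (unfold kirchhoff_matrix_def, use char_poly_matrix_closed[OF dim] in auto)
qed

lemma transpose_input_matrix:
  fixes a :: "nat \<Rightarrow> nat \<Rightarrow> 'a::comm_ring_1"
  assumes "linear_compartmental_model n M" "n > 0"
  shows "transpose_mat (mat_delete (char_poly_matrix (compartmental_matrix n M a)) 0 0) =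
    rooted_labelled_digraph.kirchhoff_matrix (leak_augmented_1 M a) 2 (n - 1)" (is "?A = ?B")
proof -
  interpret rooted_labelled_digraph "leak_augmented_1 M a" 2 "n - 1"
    using rooted_leak_augmented_1[OF assms] .
  have dim: "compartmental_matrix n M a \<in> carrier_mat n n"
    by (simp add: compartmental_matrix_def)
  note dims = carrier_matD[OF char_poly_matrix_closed[OF dim]]
  show ?thesis
  proof (rule eq_matI)
    fix r c assume "r < dim_row ?B" "c < dim_col ?B"
    then have rc: "r < n - 1" "c < n - 1" unfolding kirchhoff_matrix_def by simp_all
    then have rc': "Suc r < n" "Suc c < n" by simp_all
    have "(r + 2, c + 2) \<in> E \<longleftrightarrow> (r + 2, c + 2) \<in> parcs (model_graph M)"
      by (auto simp: leak_augmented_1_def leak_augmented_def Let_def)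
    moreover have "edge_label (leak_augmented_1 M a) (r + 2, c + 2) = a (c + 2) (r + 2)"
      by (simp add: leak_augmented_1_def leak_augmented_def Let_def)
    \<comment> \<open>Deleting index 0 shifts the zero-based indices once more, so index
      \<open>r\<close> of the minor belongs to compartment \<open>r + 2\<close>.\<close>
    moreover have "?A $$ (r, c) = char_poly_matrix (compartmental_matrix n M a) $$ (Suc c, Suc r)"
      using rc dims by (simp add: mat_delete_def)
    moreover have "Suc r + 1 = r + 2" "Suc c + 1 = c + 2" by simp_all
    ultimately show "?A $$ (r, c) = ?B $$ (r, c)"
      unfolding kirchhoff_matrix_def using rc out_sum_leak_augmented_1[OF assms(1), of "r + 2" a]
      by (simp only: char_poly_matrix_entry[OF rc'(2,1)]) auto
  qed (unfold kirchhoff_matrix_def, use dims in auto)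
qed

theorem theorem4p5:
  fixes n :: nat and M :: compartmental_model and a :: "nat \<Rightarrow> nat \<Rightarrow> 'a::comm_ring_1"
  assumes "linear_compartmental_model n M"
    and "inputs M = {1}" and "outputs M = {1}"
  shows "output_operator n M a = monom 1 n + (\<Sum>i<n. monom (output_coeff n M a i) i) \<and>
         input_operator n M a = monom 1 (n - 1) + (\<Sum>i<n - 1. monom (input_coeff n M a i) i) \<and>
         (\<forall>i<n. output_coeff n M a i =
            (\<Sum>F \<in> spanning_incoming_forests (n - i) (leak_augmented M a).
               label_product (leak_augmented M a) F)) \<and>
         (\<forall>i<n - 1. input_coeff n M a i =
            (\<Sum>F \<in> spanning_incoming_forests (n - i - 1) (leak_augmented_1 M a).
               label_product (leak_augmented_1 M a) F))"
proof -
  \<comment> \<open>Compartment 1 is an input and so belongs to \<open>{1..n}\<close>.\<close>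
  have n: "n > 0" using assms by (auto simp: linear_compartmental_model_def)
  interpret out: rooted_labelled_digraph "leak_augmented M a" 1 n
    using rooted_leak_augmented[OF assms(1)] .
  interpret inp: rooted_labelled_digraph "leak_augmented_1 M a" 2 "n - 1"
    using rooted_leak_augmented_1[OF assms(1) n] .
  have dim: "char_poly_matrix (compartmental_matrix n M a) \<in> carrier_mat n n"
    by (intro char_poly_matrix_closed) (simp add: compartmental_matrix_def)
  have out: "output_operator n M a = det out.kirchhoff_matrix"
    unfolding output_operator_def transpose_output_matrix[OF assms(1), symmetric]
    by (rule det_transpose[OF dim, symmetric])
  have inp: "input_operator n M a = det inp.kirchhoff_matrix"
    unfolding input_operator_def transpose_input_matrix[OF assms(1) n, symmetric]
    by (rule det_transpose[OF mat_delete_carrier[OF dim], symmetric])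
  have "coeff (det inp.kirchhoff_matrix) i = (\<Sum>F \<in> spanning_incoming_forests (n - i - 1)
      (leak_augmented_1 M a). label_product (leak_augmented_1 M a) F)" if "i < n - 1" for i
  proof -
    have "n - i - 1 = n - 1 - i" by simp
    with inp.coeff_det_kirchhoff_matrix[of i] that show ?thesis by (simp only: less_imp_le)
  qed
  then show ?thesis
    unfolding output_coeff_def input_coeff_def out inp
    by (intro conjI allI impI out.det_kirchhoff_matrix_expand inp.det_kirchhoff_matrix_expand
        out.coeff_det_kirchhoff_matrix less_imp_le)
qed

end
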